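(* Let $A$ be a unital associative algebra over a field $\mathbb{K}$, and let $\delta_1,\delta_2:A\to A\otimes A$ be derivations. (1) There exists a coassociative covariant derivation $\Delta:A\to A\otimes A$ with respect to $(\delta_1,\delta_2)$ if and only if there exists $u\in A\otimes A$ such that, for all $a\in A$, $$(\delta_1-\delta_2)(a)=au-ua,$$ $$(\delta_1\otimes\mathrm{id}-\mathrm{id}\otimes\delta_1)\circ\delta_1(a)=u_{23}\,\delta_1(a)_{13},$$ $$(\delta_1\otimes\mathrm{id}-\mathrm{id}\otimes\delta_1)(u)=u_{23}u_{13}-u_{12}u_{23}.$$ In this case, for all $a\in A$, $$\Delta(a)=ua+\delta_1(a)=au+\delta_2(a).$$ (2) The constant subalgebra $C(A)=\ker\delta_1\cap\ker\delta_2$ of $(A,\delta_1,\delta_2,\Delta)$ is the maximal subalgebra of $A$ over which $\Delta$ is bilinear.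
   Context: $\otimes=\otimes_{\mathbb{K}}$; $A\otimes A$ is an $A$-bimodule by $a\cdot(b\otimes c)\cdot d=ab\otimes cd$. For $r=\sum_i a_i\otimes b_i\in A\otimes A$ put $r_{12}=r\otimes 1$, $r_{13}=\sum_i a_i\otimes 1\otimes b_i$, $r_{23}=1\otimes r$; in particular $\delta_1(a)_{13}$ is obtained in this way from $\delta_1(a)\in A\otimes A$. Products are taken in $A\otimes A\otimes A$. A derivation $\delta:A\to A\otimes A$ is a $\mathbb{K}$-linear map with $\delta(ab)=a\delta(b)+\delta(a)b$. A covariant derivation with respect to $(\delta_1,\delta_2)$ is a $\mathbb{K}$-linear map $\Delta:A\to A\otimes A$ with $$\Delta(ab)=\Delta(a)b+a\delta_1(b)=a\Delta(b)+\delta_2(a)b\quad\text{for all }a,b\in A;$$ it is coassociative if $(\Delta\otimes\mathrm{id})\circ\Delta=(\mathrm{id}\otimes\Delta)\circ\Delta$. In part (2), $\Delta$ is a coassociative covariant derivation with respect to $(\delta_1,\delta_2)$ as in part (1), and $\Delta$ is bilinear over a subalgebra $B\subseteq A$ if $\Delta(ab)=\Delta(a)b$ and $\Delta(ba)=b\Delta(a)$ for all $a\in A$, $b\in B$. *)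

theory Defs
  imports Complex_Main "HOL-Library.Poly_Mapping" "HOL-Library.Set_Algebras"
begin

section \<open>Unital associative algebras\<close>

text \<open>The sort \<open>{ring, monoid_mult}\<close> is \<open>ring_1\<close> without the axiom \<open>0 \<noteq> 1\<close>, so the zero
  algebra is included.\<close>

locale unital_algebra = vector_space scale
  for scale :: "'k::field \<Rightarrow> 'a::{ring, monoid_mult} \<Rightarrow> 'a" +
  assumes scale_mult_left: "scale c a * b = scale c (a * b)"
    and scale_mult_right: "a * scale c b = scale c (a * b)"

definition subalgebra :: "('k::field \<Rightarrow> 'a::{ring, monoid_mult} \<Rightarrow> 'a) \<Rightarrow> 'a set \<Rightarrow> bool" where
  "subalgebra s B \<longleftrightarrow> module.subspace s B \<and> 1 \<in> B \<and> (\<forall>a\<in>B. \<forall>b\<in>B. a * b \<in> B)"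

section \<open>Free vector spaces\<close>

definition free_scale :: "'k::field \<Rightarrow> ('i \<Rightarrow>\<^sub>0 'k) \<Rightarrow> ('i \<Rightarrow>\<^sub>0 'k)" where
  "free_scale c = Poly_Mapping.map ((*) c)"

lemma lookup_free_scale [simp]:
  "Poly_Mapping.lookup (free_scale c p) i = c * Poly_Mapping.lookup p i"
  by (simp add: free_scale_def Poly_Mapping.map.rep_eq when_def)

interpretation free: vector_space free_scale
  by standard (auto intro!: poly_mapping_eqI simp: lookup_add algebra_simps)

abbreviation gen :: "'i \<Rightarrow> ('i \<Rightarrow>\<^sub>0 'k::field)" where
  "gen i \<equiv> Poly_Mapping.single i 1"

definition lin_ext :: "('i \<Rightarrow> ('j \<Rightarrow>\<^sub>0 'k::field)) \<Rightarrow> ('i \<Rightarrow>\<^sub>0 'k) \<Rightarrow> ('j \<Rightarrow>\<^sub>0 'k)" where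
  "lin_ext f p = (\<Sum>i\<in>Poly_Mapping.keys p. free_scale (Poly_Mapping.lookup p i) (f i))"

section \<open>The tensor products \<open>A \<otimes> A\<close> and \<open>A \<otimes> A \<otimes> A\<close>\<close>

text \<open>Both are quotients of a free vector space by the multilinearity relations; a tensor is a
  coset, i.e. a set of formal linear combinations. The sum of two cosets is their elementwise sum,
  provided by \<^theory>\<open>HOL-Library.Set_Algebras\<close>.\<close>

type_synonym ('k, 'a) tensor2 = "('a \<times> 'a \<Rightarrow>\<^sub>0 'k) set"
type_synonym ('k, 'a) tensor3 = "('a \<times> 'a \<times> 'a \<Rightarrow>\<^sub>0 'k) set"

definition relations2 ::
  "('k::field \<Rightarrow> 'a::{ring, monoid_mult} \<Rightarrow> 'a) \<Rightarrow> ('a \<times> 'a \<Rightarrow>\<^sub>0 'k) set" where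
  "relations2 s =
     {gen (a + a', b) - gen (a, b) - gen (a', b) |a a' b. True} \<union>
     {gen (a, b + b') - gen (a, b) - gen (a, b') |a b b'. True} \<union>
     {gen (s k a, b) - free_scale k (gen (a, b)) |k a b. True} \<union>
     {gen (a, s k b) - free_scale k (gen (a, b)) |k a b. True}"

definition relations3 ::
  "('k::field \<Rightarrow> 'a::{ring, monoid_mult} \<Rightarrow> 'a) \<Rightarrow> ('a \<times> 'a \<times> 'a \<Rightarrow>\<^sub>0 'k) set" where
  "relations3 s =
     {gen (a + a', b, c) - gen (a, b, c) - gen (a', b, c) |a a' b c. True} \<union>
     {gen (a, b + b', c) - gen (a, b, c) - gen (a, b', c) |a b b' c. True} \<union>
     {gen (a, b, c + c') - gen (a, b, c) - gen (a, b, c') |a b c c'. True} \<union>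
     {gen (s k a, b, c) - free_scale k (gen (a, b, c)) |k a b c. True} \<union>
     {gen (a, s k b, c) - free_scale k (gen (a, b, c)) |k a b c. True} \<union>
     {gen (a, b, s k c) - free_scale k (gen (a, b, c)) |k a b c. True}"

definition cls2 ::
  "('k::field \<Rightarrow> 'a::{ring, monoid_mult} \<Rightarrow> 'a) \<Rightarrow> ('a \<times> 'a \<Rightarrow>\<^sub>0 'k) \<Rightarrow> ('k, 'a) tensor2" where
  "cls2 s p = p +o free.span (relations2 s)"

definition cls3 ::
  "('k::field \<Rightarrow> 'a::{ring, monoid_mult} \<Rightarrow> 'a) \<Rightarrow> ('a \<times> 'a \<times> 'a \<Rightarrow>\<^sub>0 'k) \<Rightarrow> ('k, 'a) tensor3" where
  "cls3 s p = p +o free.span (relations3 s)"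

definition tensors2 ::
  "('k::field \<Rightarrow> 'a::{ring, monoid_mult} \<Rightarrow> 'a) \<Rightarrow> ('k, 'a) tensor2 set" where
  "tensors2 s = range (cls2 s)"

definition coset_minus :: "'v::ab_group_add set \<Rightarrow> 'v set \<Rightarrow> 'v set" (infixl \<open>\<ominus>\<close> 65) where
  "X \<ominus> Y = {x - y |x y. x \<in> X \<and> y \<in> Y}"

text \<open>All remaining operations choose a representative \<open>\<Sum>\<^sub>i k\<^sub>i (a\<^sub>i, b\<^sub>i)\<close>, apply the defining
  formula to it and take the class of the result; independence of the choice is proved below.\<close>

definition rep :: "'v set \<Rightarrow> 'v" where
  "rep X = (SOME x. x \<in> X)"

definition scale2 ::
  "('k::field \<Rightarrow> 'a::{ring, monoid_mult} \<Rightarrow> 'a) \<Rightarrow> 'k \<Rightarrow> ('k, 'a) tensor2 \<Rightarrow> ('k, 'a) tensor2" where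
  "scale2 s k r = cls2 s (free_scale k (rep r))"

definition left_act ::
  "('k::field \<Rightarrow> 'a::{ring, monoid_mult} \<Rightarrow> 'a) \<Rightarrow> 'a \<Rightarrow> ('k, 'a) tensor2 \<Rightarrow> ('k, 'a) tensor2"
  (infixr \<open>\<rightharpoonup>\<index>\<close> 75) where
  "a \<rightharpoonup>\<^bsub>s\<^esub> r = cls2 s (lin_ext (\<lambda>(b, c). gen (a * b, c)) (rep r))"

definition right_act ::
  "('k::field \<Rightarrow> 'a::{ring, monoid_mult} \<Rightarrow> 'a) \<Rightarrow> ('k, 'a) tensor2 \<Rightarrow> 'a \<Rightarrow> ('k, 'a) tensor2"
  (infixl \<open>\<leftharpoonup>\<index>\<close> 75) where
  "r \<leftharpoonup>\<^bsub>s\<^esub> d = cls2 s (lin_ext (\<lambda>(b, c). gen (b, c * d)) (rep r))"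

definition mult3 ::
  "('k::field \<Rightarrow> 'a::{ring, monoid_mult} \<Rightarrow> 'a) \<Rightarrow>
     ('k, 'a) tensor3 \<Rightarrow> ('k, 'a) tensor3 \<Rightarrow> ('k, 'a) tensor3"
  (infixl \<open>\<odot>\<index>\<close> 70) where
  "X \<odot>\<^bsub>s\<^esub> Y = cls3 s
     (lin_ext (\<lambda>(a, b, c). lin_ext (\<lambda>(a', b', c'). gen (a * a', b * b', c * c')) (rep Y)) (rep X))"

definition leg12 ::
  "('k::field \<Rightarrow> 'a::{ring, monoid_mult} \<Rightarrow> 'a) \<Rightarrow> ('k, 'a) tensor2 \<Rightarrow> ('k, 'a) tensor3" where
  "leg12 s r = cls3 s (lin_ext (\<lambda>(a, b). gen (a, b, 1)) (rep r))"

definition leg13 ::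
  "('k::field \<Rightarrow> 'a::{ring, monoid_mult} \<Rightarrow> 'a) \<Rightarrow> ('k, 'a) tensor2 \<Rightarrow> ('k, 'a) tensor3" where
  "leg13 s r = cls3 s (lin_ext (\<lambda>(a, b). gen (a, 1, b)) (rep r))"

definition leg23 ::
  "('k::field \<Rightarrow> 'a::{ring, monoid_mult} \<Rightarrow> 'a) \<Rightarrow> ('k, 'a) tensor2 \<Rightarrow> ('k, 'a) tensor3" where
  "leg23 s r = cls3 s (lin_ext (\<lambda>(a, b). gen (1, a, b)) (rep r))"

text \<open>\<open>f \<otimes> id\<close> and \<open>id \<otimes> f\<close> for a linear map \<open>f : A \<rightarrow> A \<otimes> A\<close>:\<close>

definition tensor_id ::
  "('k::field \<Rightarrow> 'a::{ring, monoid_mult} \<Rightarrow> 'a) \<Rightarrow>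
     ('a \<Rightarrow> ('k, 'a) tensor2) \<Rightarrow> ('k, 'a) tensor2 \<Rightarrow> ('k, 'a) tensor3" where
  "tensor_id s f r = cls3 s
     (lin_ext (\<lambda>(a, b). lin_ext (\<lambda>(x, y). gen (x, y, b)) (rep (f a))) (rep r))"

definition id_tensor ::
  "('k::field \<Rightarrow> 'a::{ring, monoid_mult} \<Rightarrow> 'a) \<Rightarrow>
     ('a \<Rightarrow> ('k, 'a) tensor2) \<Rightarrow> ('k, 'a) tensor2 \<Rightarrow> ('k, 'a) tensor3" where
  "id_tensor s f r = cls3 s
     (lin_ext (\<lambda>(a, b). lin_ext (\<lambda>(x, y). gen (a, x, y)) (rep (f b))) (rep r))"

section \<open>Derivations and covariant derivations\<close>

definition linear2 ::
  "('k::field \<Rightarrow> 'a::{ring, monoid_mult} \<Rightarrow> 'a) \<Rightarrow> ('a \<Rightarrow> ('k, 'a) tensor2) \<Rightarrow> bool" where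
  "linear2 s f \<longleftrightarrow>
     (\<forall>a. f a \<in> tensors2 s) \<and>
     (\<forall>a b. f (a + b) = f a + f b) \<and>
     (\<forall>k a. f (s k a) = scale2 s k (f a))"

definition derivation ::
  "('k::field \<Rightarrow> 'a::{ring, monoid_mult} \<Rightarrow> 'a) \<Rightarrow> ('a \<Rightarrow> ('k, 'a) tensor2) \<Rightarrow> bool" where
  "derivation s \<delta> \<longleftrightarrow>
     linear2 s \<delta> \<and> (\<forall>a b. \<delta> (a * b) = a \<rightharpoonup>\<^bsub>s\<^esub> \<delta> b + \<delta> a \<leftharpoonup>\<^bsub>s\<^esub> b)"

definition covariant_derivation ::
  "('k::field \<Rightarrow> 'a::{ring, monoid_mult} \<Rightarrow> 'a) \<Rightarrow> ('a \<Rightarrow> ('k, 'a) tensor2) \<Rightarrow>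
     ('a \<Rightarrow> ('k, 'a) tensor2) \<Rightarrow> ('a \<Rightarrow> ('k, 'a) tensor2) \<Rightarrow> bool" where
  "covariant_derivation s \<delta>1 \<delta>2 \<Delta> \<longleftrightarrow>
     linear2 s \<Delta> \<and>
     (\<forall>a b. \<Delta> (a * b) = \<Delta> a \<leftharpoonup>\<^bsub>s\<^esub> b + a \<rightharpoonup>\<^bsub>s\<^esub> \<delta>1 b) \<and>
     (\<forall>a b. \<Delta> (a * b) = a \<rightharpoonup>\<^bsub>s\<^esub> \<Delta> b + \<delta>2 a \<leftharpoonup>\<^bsub>s\<^esub> b)"

definition coassociative ::
  "('k::field \<Rightarrow> 'a::{ring, monoid_mult} \<Rightarrow> 'a) \<Rightarrow> ('a \<Rightarrow> ('k, 'a) tensor2) \<Rightarrow> bool" where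
  "coassociative s \<Delta> \<longleftrightarrow> (\<forall>a. tensor_id s \<Delta> (\<Delta> a) = id_tensor s \<Delta> (\<Delta> a))"

definition compatible_element ::
  "('k::field \<Rightarrow> 'a::{ring, monoid_mult} \<Rightarrow> 'a) \<Rightarrow> ('a \<Rightarrow> ('k, 'a) tensor2) \<Rightarrow>
     ('a \<Rightarrow> ('k, 'a) tensor2) \<Rightarrow> ('k, 'a) tensor2 \<Rightarrow> bool" where
  "compatible_element s \<delta>1 \<delta>2 u \<longleftrightarrow>
     u \<in> tensors2 s \<and>
     (\<forall>a. \<delta>1 a \<ominus> \<delta>2 a = a \<rightharpoonup>\<^bsub>s\<^esub> u \<ominus> u \<leftharpoonup>\<^bsub>s\<^esub> a) \<and>
     (\<forall>a. tensor_id s \<delta>1 (\<delta>1 a) \<ominus> id_tensor s \<delta>1 (\<delta>1 a) = leg23 s u \<odot>\<^bsub>s\<^esub> leg13 s (\<delta>1 a)) \<and>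
     tensor_id s \<delta>1 u \<ominus> id_tensor s \<delta>1 u
       = leg23 s u \<odot>\<^bsub>s\<^esub> leg13 s u \<ominus> leg12 s u \<odot>\<^bsub>s\<^esub> leg23 s u"

definition bilinear_over ::
  "('k::field \<Rightarrow> 'a::{ring, monoid_mult} \<Rightarrow> 'a) \<Rightarrow> 'a set \<Rightarrow> ('a \<Rightarrow> ('k, 'a) tensor2) \<Rightarrow> bool" where
  "bilinear_over s B \<Delta> \<longleftrightarrow>
     (\<forall>a. \<forall>b\<in>B. \<Delta> (a * b) = \<Delta> a \<leftharpoonup>\<^bsub>s\<^esub> b \<and> \<Delta> (b * a) = b \<rightharpoonup>\<^bsub>s\<^esub> \<Delta> a)"

definition constant_subalgebra ::
  "('k::field \<Rightarrow> 'a::{ring, monoid_mult} \<Rightarrow> 'a) \<Rightarrow> ('a \<Rightarrow> ('k, 'a) tensor2) \<Rightarrow>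
     ('a \<Rightarrow> ('k, 'a) tensor2) \<Rightarrow> 'a set" where
  "constant_subalgebra s \<delta>1 \<delta>2 = {a. \<delta>1 a = cls2 s 0} \<inter> {a. \<delta>2 a = cls2 s 0}"

section \<open>Independence of representatives\<close>

lemma lin_ext_superset:
  assumes "finite S" "Poly_Mapping.keys p \<subseteq> S"
  shows "lin_ext f p = (\<Sum>i\<in>S. free_scale (Poly_Mapping.lookup p i) (f i))"
  unfolding lin_ext_def using assms
  by (intro sum.mono_neutral_left) (auto simp: in_keys_iff)

lemma lin_ext_gen [simp]: "lin_ext f (gen i) = f i"
  by (simp add: lin_ext_def)

lemma lin_ext_add: "lin_ext f (p + q) = lin_ext f p + lin_ext f q"
proof -
  let ?S = "Poly_Mapping.keys p \<union> Poly_Mapping.keys q"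
  have "Poly_Mapping.keys (p + q) \<subseteq> ?S" by (rule keys_add)
  then show ?thesis
    by (simp add: lin_ext_superset[of ?S] lookup_add free.scale_left_distrib sum.distrib)
qed

lemma lin_ext_scale: "lin_ext f (free_scale c p) = free_scale c (lin_ext f p)"
proof -
  have "Poly_Mapping.keys (free_scale c p) \<subseteq> Poly_Mapping.keys p"
    by (auto simp: in_keys_iff)
  then show ?thesis
    by (simp add: lin_ext_superset[of "Poly_Mapping.keys p"] free.scale_sum_right)
qed

lemma linear_lin_ext: "Vector_Spaces.linear free_scale free_scale (lin_ext f)"
  by unfold_locales (simp_all add: lin_ext_add lin_ext_scale)

lemma lin_ext_diff: "lin_ext f (p - q) = lin_ext f p - lin_ext f q"
  by (rule module_hom.diff) (rule linear_lin_ext[unfolded Vector_Spaces.linear_def, THEN conjunct2, THEN conjunct2])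

lemma lin_ext_in_span:
  assumes "p \<in> free.span R" and "\<And>r. r \<in> R \<Longrightarrow> lin_ext f r \<in> free.span R'"
  shows "lin_ext f p \<in> free.span R'"
  using assms(1)
proof (induction rule: free.span_induct_alt)
  case base
  show ?case by (simp add: lin_ext_def free.span_zero)
next
  case (step c x y)
  then show ?case
    by (simp add: lin_ext_add lin_ext_scale free.span_add free.span_scale assms(2))
qed

lemma lin_ext_pointwise_in_span:
  assumes "\<And>i. f i - g i \<in> free.span R"
  shows "lin_ext f p - lin_ext g p \<in> free.span R"
  unfolding lin_ext_def sum_subtractf[symmetric] free.scale_right_diff_distrib[symmetric]
  using assms by (intro free.span_sum free.span_scale)

lemma coset_eq_iff:
  "p +o free.span R = q +o free.span R \<longleftrightarrow> p - q \<in> free.span R"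
proof
  assume "p +o free.span R = q +o free.span R"
  then have "p \<in> q +o free.span R"
    using free.span_zero[of R] by (auto simp: elt_set_plus_def)
  then show "p - q \<in> free.span R" by (auto simp: elt_set_plus_def)
next
  assume *: "p - q \<in> free.span R"
  have "x - q \<in> free.span R \<longleftrightarrow> x - p \<in> free.span R" for x
    using free.span_add[OF _ *, of "x - p"] free.span_diff[OF _ *, of "x - q"] by auto
  moreover have "x \<in> y +o free.span R \<longleftrightarrow> x - y \<in> free.span R" for x y
    by (auto simp: elt_set_plus_def intro!: bexI[of _ "x - y"])
  ultimately show "p +o free.span R = q +o free.span R" by blast
qed

lemma rep_coset: "rep (p +o free.span R) - p \<in> free.span R"
proof -
  have "p \<in> p +o free.span R"
    using free.span_zero[of R] by (auto simp: elt_set_plus_def)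
  then have "rep (p +o free.span R) \<in> p +o free.span R"
    unfolding rep_def by (rule someI)
  then show ?thesis by (auto simp: elt_set_plus_def)
qed

lemma cls2_eq_iff: "cls2 s p = cls2 s q \<longleftrightarrow> p - q \<in> free.span (relations2 s)"
  by (simp add: cls2_def coset_eq_iff)

lemma cls3_eq_iff: "cls3 s p = cls3 s q \<longleftrightarrow> p - q \<in> free.span (relations3 s)"
  by (simp add: cls3_def coset_eq_iff)

lemma coset_plus: "(p +o free.span R) + (q +o free.span R) = (p + q) +o free.span R"
proof -
  have "free.span R + free.span R = free.span R"
    using free.span_zero[of R]
    by (auto simp: set_plus_def intro: free.span_add) (metis add.left_neutral)
  then show ?thesis by (simp add: set_plus_rearrange)
qed

lemma coset_minus: "(p +o free.span R) \<ominus> (q +o free.span R) = (p - q) +o free.span R"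
proof (intro set_eqI iffI)
  fix x assume "x \<in> (p +o free.span R) \<ominus> (q +o free.span R)"
  then obtain m n where "m \<in> free.span R" "n \<in> free.span R" "x = (p + m) - (q + n)"
    by (auto simp: coset_minus_def elt_set_plus_def)
  then show "x \<in> (p - q) +o free.span R"
    by (auto simp: elt_set_plus_def algebra_simps intro!: bexI[of _ "m - n"] free.span_diff)
next
  fix x assume "x \<in> (p - q) +o free.span R"
  then obtain m where "m \<in> free.span R" "x = (p + m) - (q + 0)"
    by (auto simp: elt_set_plus_def algebra_simps)
  then show "x \<in> (p +o free.span R) \<ominus> (q +o free.span R)"
    unfolding coset_minus_def elt_set_plus_def using free.span_zero[of R] by blast
qed

lemma cls2_add: "cls2 s p + cls2 s q = cls2 s (p + q)"
  by (simp add: cls2_def coset_plus)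

lemma cls2_minus: "cls2 s p \<ominus> cls2 s q = cls2 s (p - q)"
  by (simp add: cls2_def coset_minus)

lemma cls3_minus: "cls3 s p \<ominus> cls3 s q = cls3 s (p - q)"
  by (simp add: cls3_def coset_minus)

lemma scale2_cls2: "scale2 s k (cls2 s p) = cls2 s (free_scale k p)"
  unfolding scale2_def cls2_eq_iff free.scale_right_diff_distrib[symmetric]
  unfolding cls2_def by (intro free.span_scale rep_coset)

text \<open>A map of basis elements that sends the relations to relations induces a map of classes.\<close>

lemma lin_ext_rep2:
  assumes "\<And>r. r \<in> relations2 s \<Longrightarrow> lin_ext f r \<in> free.span R"
  shows "lin_ext f (rep (cls2 s p)) - lin_ext f p \<in> free.span R"
  unfolding lin_ext_diff[symmetric] cls2_def
  by (rule lin_ext_in_span[OF rep_coset assms])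

lemma lin_ext_rep3:
  assumes "\<And>r. r \<in> relations3 s \<Longrightarrow> lin_ext f r \<in> free.span R"
  shows "lin_ext f (rep (cls3 s p)) - lin_ext f p \<in> free.span R"
  unfolding lin_ext_diff[symmetric] cls3_def
  by (rule lin_ext_in_span[OF rep_coset assms])

lemma relations2_lin_ext:
  assumes "\<And>a a' b. f (a + a', b) - f (a, b) - f (a', b) \<in> S"
    and "\<And>a b b'. f (a, b + b') - f (a, b) - f (a, b') \<in> S"
    and "\<And>k a b. f (s k a, b) - free_scale k (f (a, b)) \<in> S"
    and "\<And>k a b. f (a, s k b) - free_scale k (f (a, b)) \<in> S"
    and "r \<in> relations2 s"
  shows "lin_ext f r \<in> S"
  using assms(5) unfolding relations2_def
  by (auto simp: lin_ext_diff lin_ext_scale intro: assms(1-4))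

lemma relations3_lin_ext:
  assumes "\<And>a a' b c. f (a + a', b, c) - f (a, b, c) - f (a', b, c) \<in> S"
    and "\<And>a b b' c. f (a, b + b', c) - f (a, b, c) - f (a, b', c) \<in> S"
    and "\<And>a b c c'. f (a, b, c + c') - f (a, b, c) - f (a, b, c') \<in> S"
    and "\<And>k a b c. f (s k a, b, c) - free_scale k (f (a, b, c)) \<in> S"
    and "\<And>k a b c. f (a, s k b, c) - free_scale k (f (a, b, c)) \<in> S"
    and "\<And>k a b c. f (a, b, s k c) - free_scale k (f (a, b, c)) \<in> S"
    and "r \<in> relations3 s"
  shows "lin_ext f r \<in> S"
  using assms(7) unfolding relations3_def
  by (auto simp: lin_ext_diff lin_ext_scale intro: assms(1-6))

lemma relations2_span:
  "gen (a + a', b) - gen (a, b) - gen (a', b) \<in> free.span (relations2 s)"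
  "gen (a, b + b') - gen (a, b) - gen (a, b') \<in> free.span (relations2 s)"
  "gen (s k a, b) - free_scale k (gen (a, b)) \<in> free.span (relations2 s)"
  "gen (a, s k b) - free_scale k (gen (a, b)) \<in> free.span (relations2 s)"
  unfolding relations2_def by (rule free.span_base, simp only: Un_iff mem_Collect_eq, metis)+

lemma relations3_span:
  "gen (a + a', b, c) - gen (a, b, c) - gen (a', b, c) \<in> free.span (relations3 s)"
  "gen (a, b + b', c) - gen (a, b, c) - gen (a, b', c) \<in> free.span (relations3 s)"
  "gen (a, b, c + c') - gen (a, b, c) - gen (a, b, c') \<in> free.span (relations3 s)"
  "gen (s k a, b, c) - free_scale k (gen (a, b, c)) \<in> free.span (relations3 s)"
  "gen (a, s k b, c) - free_scale k (gen (a, b, c)) \<in> free.span (relations3 s)"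
  "gen (a, b, s k c) - free_scale k (gen (a, b, c)) \<in> free.span (relations3 s)"
  unfolding relations3_def by (rule free.span_base, simp only: Un_iff mem_Collect_eq, metis)+

lemma leg_cls2:
  "leg12 s (cls2 s p) = cls3 s (lin_ext (\<lambda>(a, b). gen (a, b, 1)) p)"
  "leg13 s (cls2 s p) = cls3 s (lin_ext (\<lambda>(a, b). gen (a, 1, b)) p)"
  "leg23 s (cls2 s p) = cls3 s (lin_ext (\<lambda>(a, b). gen (1, a, b)) p)"
  unfolding leg12_def leg13_def leg23_def cls3_eq_iff
  by (rule lin_ext_rep2, erule relations2_lin_ext[rotated -1], simp_all add: relations3_span)+

lemma lin_ext_bilinear_aux:
  fixes p :: "'i \<Rightarrow>\<^sub>0 'k::field"
  shows "(\<And>i. f i - g i - h i \<in> free.span R) \<Longrightarrow>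
      lin_ext f p - lin_ext g p - lin_ext h p \<in> free.span R"
    and "(\<And>i. f i - free_scale k (g i) \<in> free.span R) \<Longrightarrow>
      lin_ext f p - free_scale k (lin_ext g p) \<in> free.span R"
proof -
  assume *: "\<And>i. f i - g i - h i \<in> free.span R"
  have "lin_ext f p - lin_ext (\<lambda>i. g i + h i) p \<in> free.span R"
    by (rule lin_ext_pointwise_in_span) (use * in \<open>simp add: diff_diff_eq\<close>)
  then show "lin_ext f p - lin_ext g p - lin_ext h p \<in> free.span R"
    by (simp add: lin_ext_def free.scale_right_distrib sum.distrib diff_diff_eq)
next
  assume *: "\<And>i. f i - free_scale k (g i) \<in> free.span R"
  have "lin_ext f p - lin_ext (\<lambda>i. free_scale k (g i)) p \<in> free.span R"
    by (rule lin_ext_pointwise_in_span) (use * in simp)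
  then show "lin_ext f p - free_scale k (lin_ext g p) \<in> free.span R"
    by (simp add: lin_ext_def free.scale_sum_right mult.commute)
qed

context unital_algebra
begin

lemma act_cls2:
  "a \<rightharpoonup>\<^bsub>scale\<^esub> cls2 scale p = cls2 scale (lin_ext (\<lambda>(b, c). gen (a * b, c)) p)"
  "cls2 scale p \<leftharpoonup>\<^bsub>scale\<^esub> d = cls2 scale (lin_ext (\<lambda>(b, c). gen (b, c * d)) p)"
  unfolding left_act_def right_act_def cls2_eq_iff
  by (rule lin_ext_rep2, erule relations2_lin_ext[rotated -1],
      simp_all add: relations2_span distrib_left distrib_right scale_mult_left scale_mult_right)+

lemma mult3_cls3:
  "cls3 scale p \<odot>\<^bsub>scale\<^esub> cls3 scale q = cls3 scale
     (lin_ext (\<lambda>(a, b, c). lin_ext (\<lambda>(a', b', c'). gen (a * a', b * b', c * c')) q) p)"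
proof -
  let ?f = "\<lambda>q (a, b, c). lin_ext (\<lambda>(a', b', c'). gen (a * a', b * b', c * c')) q"
  let ?N = "free.span (relations3 scale)"
  have "lin_ext (?f (rep (cls3 scale q))) (rep (cls3 scale p)) -
      lin_ext (?f (rep (cls3 scale q))) p \<in> ?N"
    by (rule lin_ext_rep3, erule relations3_lin_ext[rotated -1])
       (auto intro!: lin_ext_bilinear_aux
          simp: relations3_span distrib_right scale_mult_left split: prod.splits)
  moreover have "lin_ext (?f (rep (cls3 scale q))) p - lin_ext (?f q) p \<in> ?N"
    by (rule lin_ext_pointwise_in_span, clarsimp, rule lin_ext_rep3,
        erule relations3_lin_ext[rotated -1])
       (auto simp: relations3_span distrib_left scale_mult_right)
  ultimately have "lin_ext (?f (rep (cls3 scale q))) (rep (cls3 scale p)) - lin_ext (?f q) p \<in> ?N"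
    using free.span_add by fastforce
  then show ?thesis unfolding mult3_def cls3_eq_iff .
qed

lemma tensor_id_cls2:
  assumes "linear2 scale f" and "\<And>a. f a = cls2 scale (g a)"
  shows "tensor_id scale f (cls2 scale p) = cls3 scale
      (lin_ext (\<lambda>(a, b). lin_ext (\<lambda>(x, y). gen (x, y, b)) (g a)) p)" (is ?left)
    and "id_tensor scale f (cls2 scale p) = cls3 scale
      (lin_ext (\<lambda>(a, b). lin_ext (\<lambda>(x, y). gen (a, x, y)) (g b)) p)" (is ?right)
proof -
  let ?N = "free.span (relations3 scale)"
  have add: "g (a + a') - g a - g a' \<in> free.span (relations2 scale)" for a a'
    using assms unfolding linear2_def by (simp add: cls2_add cls2_eq_iff diff_diff_eq)
  have scl: "g (scale k a) - free_scale k (g a) \<in> free.span (relations2 scale)" for k a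
    using assms unfolding linear2_def by (simp add: scale2_cls2 cls2_eq_iff)
  have L: "lin_ext (\<lambda>(x, y). gen (x, y, b)) r \<in> ?N"
    and R: "lin_ext (\<lambda>(x, y). gen (b, x, y)) r \<in> ?N" if "r \<in> relations2 scale" for r b
    using that by - (erule relations2_lin_ext[rotated -1], simp_all add: relations3_span)+
  note LS = lin_ext_in_span[OF add L] lin_ext_in_span[OF scl L]
  note RS = lin_ext_in_span[OF add R] lin_ext_in_span[OF scl R]
  note LS' = LS[unfolded lin_ext_diff lin_ext_scale] and RS' = RS[unfolded lin_ext_diff lin_ext_scale]
  let ?F = "\<lambda>g (a, b). lin_ext (\<lambda>(x, y). gen (x, y, b)) (g a)"
  let ?G = "\<lambda>g (a, b). lin_ext (\<lambda>(x, y). gen (a, x, y)) (g b)"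
  have "lin_ext (?F g) (rep (cls2 scale p)) - lin_ext (?F g) p \<in> ?N"
    by (rule lin_ext_rep2, erule relations2_lin_ext[rotated -1])
       (auto intro!: lin_ext_bilinear_aux LS' simp: relations3_span split: prod.splits)
  moreover have "lin_ext (?F (\<lambda>a. rep (f a))) (rep (cls2 scale p)) -
      lin_ext (?F g) (rep (cls2 scale p)) \<in> ?N"
    by (rule lin_ext_pointwise_in_span) (auto simp: assms(2) intro!: lin_ext_rep2 L)
  ultimately show ?left
    unfolding tensor_id_def cls3_eq_iff using free.span_add by fastforce
  have "lin_ext (?G g) (rep (cls2 scale p)) - lin_ext (?G g) p \<in> ?N"
    by (rule lin_ext_rep2, erule relations2_lin_ext[rotated -1])
       (auto intro!: lin_ext_bilinear_aux RS' simp: relations3_span split: prod.splits)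
  moreover have "lin_ext (?G (\<lambda>a. rep (f a))) (rep (cls2 scale p)) -
      lin_ext (?G g) (rep (cls2 scale p)) \<in> ?N"
    by (rule lin_ext_pointwise_in_span) (auto simp: assms(2) intro!: lin_ext_rep2 R)
  ultimately show ?right
    unfolding id_tensor_def cls3_eq_iff using free.span_add by fastforce
qed

end

end

theory Submission
  imports Defs
begin

text \<open>A covariant derivation is determined by \<open>u = \<Delta>(1)\<close> through \<open>\<Delta>(a) = u a + \<delta>\<^sub>1(a)\<close>. Write \<open>D\<close>
  for \<open>\<delta>\<^sub>1 \<otimes> id - id \<otimes> \<delta>\<^sub>1\<close>. The Leibniz rule gives \<open>D(u a) = D(u) a - u\<^sub>1\<^sub>2 \<delta>\<^sub>1(a)\<^sub>2\<^sub>3\<close>, and this error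
  term cancels in the coassociator of \<open>\<Delta>\<close> at \<open>a\<close>, which becomes
  \<open>(u\<^sub>1\<^sub>2 u\<^sub>2\<^sub>3 + D(u) - u\<^sub>2\<^sub>3 u\<^sub>1\<^sub>3) a + D(\<delta>\<^sub>1(a)) - u\<^sub>2\<^sub>3 \<delta>\<^sub>1(a)\<^sub>1\<^sub>3\<close>. At \<open>a = 1\<close> only the bracket survives.
  Bilinearity over \<open>b\<close> means \<open>a \<delta>\<^sub>1(b) = 0\<close> and \<open>\<delta>\<^sub>2(b) a = 0\<close> for all \<open>a\<close>; the case \<open>a = 1\<close> suffices.\<close>

section \<open>Tensors as sums of pure tensors\<close>

text \<open>The type \<open>tensor3\<close> contains every set of formal combinations. Membership
  here singles out the genuine cosets, on which elementwise addition obeys the laws of a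
  group.\<close>

definition tensors3 ::
  "('k::field \<Rightarrow> 'a::{ring, monoid_mult} \<Rightarrow> 'a) \<Rightarrow> ('k, 'a) tensor3 set" where
  "tensors3 s = range (cls3 s)"

definition pure2 ::
  "('k::field \<Rightarrow> 'a::{ring, monoid_mult} \<Rightarrow> 'a) \<Rightarrow> 'a \<Rightarrow> 'a \<Rightarrow> ('k, 'a) tensor2" where
  "pure2 s a b = cls2 s (gen (a, b))"

definition pure3 ::
  "('k::field \<Rightarrow> 'a::{ring, monoid_mult} \<Rightarrow> 'a) \<Rightarrow> 'a \<Rightarrow> 'a \<Rightarrow> 'a \<Rightarrow> ('k, 'a) tensor3" where
  "pure3 s a b c = cls3 s (gen (a, b, c))"

section \<open>The additive groups of cosets\<close>

lemma cls3_add: "cls3 s p + cls3 s q = cls3 s (p + q)"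
  by (simp add: cls3_def coset_plus)

lemma cls2_in_tensors2 [simp]: "cls2 s p \<in> tensors2 s"
  by (simp add: tensors2_def)

lemma cls3_in_tensors3 [simp]: "cls3 s p \<in> tensors3 s"
  by (simp add: tensors3_def)

lemma pure2_in_tensors2 [simp]: "pure2 s a b \<in> tensors2 s"
  by (simp add: pure2_def)

lemma pure3_in_tensors3 [simp]: "pure3 s a b c \<in> tensors3 s"
  by (simp add: pure3_def)

lemma tensors2_add [simp]: "x \<in> tensors2 s \<Longrightarrow> y \<in> tensors2 s \<Longrightarrow> x + y \<in> tensors2 s"
  by (auto simp: tensors2_def cls2_add)

lemma tensors3_add [simp]: "x \<in> tensors3 s \<Longrightarrow> y \<in> tensors3 s \<Longrightarrow> x + y \<in> tensors3 s"
  by (auto simp: tensors3_def cls3_add)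

text \<open>Elementwise addition of arbitrary sets is not cancellative. For cosets both equations
  say that the same difference of representatives lies in the span of the relations.\<close>

lemma tensors2_cancel:
  "x \<in> tensors2 s \<Longrightarrow> y \<in> tensors2 s \<Longrightarrow> z \<in> tensors2 s \<Longrightarrow> x + z = y + z \<longleftrightarrow> x = y"
  unfolding tensors2_def by (elim rangeE) (simp add: cls2_add cls2_eq_iff)

lemma tensors3_cancel:
  "x \<in> tensors3 s \<Longrightarrow> y \<in> tensors3 s \<Longrightarrow> z \<in> tensors3 s \<Longrightarrow> x + z = y + z \<longleftrightarrow> x = y"
  unfolding tensors3_def by (elim rangeE) (simp add: cls3_add cls3_eq_iff)

text \<open>Turning differences of cosets into sums leaves only an associative and commutative
  operation, which rewriting can normalise.\<close>

lemma tensors2_minus_eq_minus_iff: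
  assumes "x \<in> tensors2 s" "y \<in> tensors2 s" "z \<in> tensors2 s" "w \<in> tensors2 s"
  shows "x \<ominus> y = z \<ominus> w \<longleftrightarrow> x + w = z + y"
  using assms unfolding tensors2_def
  by (elim rangeE) (simp add: cls2_add cls2_minus cls2_eq_iff algebra_simps)

lemma tensors3_minus_eq_minus_iff:
  assumes "x \<in> tensors3 s" "y \<in> tensors3 s" "z \<in> tensors3 s" "w \<in> tensors3 s"
  shows "x \<ominus> y = z \<ominus> w \<longleftrightarrow> x + w = z + y"
  using assms unfolding tensors3_def
  by (elim rangeE) (simp add: cls3_add cls3_minus cls3_eq_iff algebra_simps)

lemma tensors3_minus_eq_iff:
  assumes "x \<in> tensors3 s" "y \<in> tensors3 s" "z \<in> tensors3 s"
  shows "x \<ominus> y = z \<longleftrightarrow> x = z + y"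
  using assms unfolding tensors3_def
  by (elim rangeE) (simp add: cls3_add cls3_minus cls3_eq_iff algebra_simps)

text \<open>The zero tensor is the span of the relations, whereas the neutral element of set
  addition is \<open>{0}\<close>, so the usual laws for zero have to be proved for cosets.\<close>

lemma tensors2_add_zero [simp]:
  "x \<in> tensors2 s \<Longrightarrow> x + cls2 s 0 = x"
  "x \<in> tensors2 s \<Longrightarrow> cls2 s 0 + x = x"
  by (auto simp: tensors2_def cls2_add)

lemma tensors2_add_eq_left_iff:
  "x \<in> tensors2 s \<Longrightarrow> y \<in> tensors2 s \<Longrightarrow> x = x + y \<longleftrightarrow> y = cls2 s 0"
  using tensors2_cancel[of "cls2 s 0" s y x] by (auto simp: add.commute)

section \<open>Formal combinations and induction on pure tensors\<close>

lemma lin_ext_fun_add: "lin_ext (\<lambda>i. f i + g i) p = lin_ext f p + lin_ext g p"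
  by (simp add: lin_ext_def free.scale_right_distrib sum.distrib)

lemma free_induct [case_names zero gen add]:
  assumes "P 0" and "\<And>k i. P (free_scale k (gen i))" and "\<And>p q. P p \<Longrightarrow> P q \<Longrightarrow> P (p + q)"
  shows "P p"
proof (induction p rule: Poly_Mapping.update_induct)
  case const
  show ?case by (rule assms(1))
next
  case (update p i k)
  \<comment> \<open>The induction rule supplies that \<open>i\<close> is not a key of
    \<open>p\<close>, so the update overwrites nothing and just adds one term.\<close>
  have "Poly_Mapping.update i k p = p + free_scale k (gen i)"
    using update.hyps
    by (intro poly_mapping_eqI) (auto simp: lookup_add lookup_update lookup_single when_def in_keys_iff)
  then show ?case using assms(2,3) update.IH by simp
qed

text \<open>A coefficient can be absorbed into the first factor of a pure tensor, so every tensor is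
  a sum of pure tensors and no case for scalars remains.\<close>

lemma tensors2_induct [consumes 1, case_names pure add]:
  assumes "x \<in> tensors2 s" and "\<And>a b. P (pure2 s a b)"
    and "\<And>x y. x \<in> tensors2 s \<Longrightarrow> y \<in> tensors2 s \<Longrightarrow> P x \<Longrightarrow> P y \<Longrightarrow> P (x + y)"
  shows "P x"
proof -
  have pure: "P (cls2 s (free_scale k (gen i)))" for k i
  proof (cases i)
    case (Pair a b)
    have "cls2 s (free_scale k (gen (a, b))) = pure2 s (s k a) b"
      by (rule sym) (simp add: pure2_def cls2_eq_iff relations2_span)
    then show ?thesis using assms(2) Pair by simp
  qed
  have "P (cls2 s p)" for p
  proof (induction p rule: free_induct)
    case (add p q)
    then show ?case by (simp flip: cls2_add add: assms(3))
  \<comment> \<open>The zero tensor is itself pure: it is a generator with coefficient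
    \<open>0\<close>.\<close>
  qed (use pure[of 0] in \<open>simp_all add: pure\<close>)
  then show ?thesis using assms(1) by (auto simp: tensors2_def)
qed

lemma tensors3_induct [consumes 1, case_names pure add]:
  assumes "x \<in> tensors3 s" and "\<And>a b c. P (pure3 s a b c)"
    and "\<And>x y. x \<in> tensors3 s \<Longrightarrow> y \<in> tensors3 s \<Longrightarrow> P x \<Longrightarrow> P y \<Longrightarrow> P (x + y)"
  shows "P x"
proof -
  have pure: "P (cls3 s (free_scale k (gen i)))" for k i
  proof (cases i)
    case (fields a b c)
    have "cls3 s (free_scale k (gen (a, b, c))) = pure3 s (s k a) b c"
      by (rule sym) (simp add: pure3_def cls3_eq_iff relations3_span)
    then show ?thesis using assms(2) fields by simp
  qed
  have "P (cls3 s p)" for p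
  proof (induction p rule: free_induct)
    case (add p q)
    then show ?case by (simp flip: cls3_add add: assms(3))
  qed (use pure[of 0] in \<open>simp_all add: pure\<close>)
  then show ?thesis using assms(1) by (auto simp: tensors3_def)
qed

section \<open>Scalars, legs and linear maps into \<open>A \<otimes> A\<close>\<close>

lemma scale2_in_tensors2 [simp]: "scale2 s k x \<in> tensors2 s"
  by (simp add: scale2_def)

lemma scale2_add:
  "x \<in> tensors2 s \<Longrightarrow> y \<in> tensors2 s \<Longrightarrow> scale2 s k (x + y) = scale2 s k x + scale2 s k y"
  by (auto simp: tensors2_def cls2_add scale2_cls2 free.scale_right_distrib)

text \<open>The scalar goes into the second factor because that is where the right action
  multiplies; this form serves the linearity of \<open>a \<mapsto> x a\<close>.\<close>

lemma scale2_pure2: "scale2 s k (pure2 s a b) = pure2 s a (s k b)"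
  by (rule sym) (simp add: pure2_def scale2_cls2 cls2_eq_iff relations2_span)

lemma scale2_zero: "scale2 s k (cls2 s 0) = cls2 s 0"
  by (simp add: scale2_cls2)

lemma pure2_add_right: "pure2 s a (b + b') = pure2 s a b + pure2 s a b'"
  by (simp add: pure2_def cls2_add cls2_eq_iff diff_diff_eq[symmetric] relations2_span)

lemma leg_in_tensors3 [simp]:
  "leg12 s x \<in> tensors3 s" "leg13 s x \<in> tensors3 s" "leg23 s x \<in> tensors3 s"
  by (simp_all add: leg12_def leg13_def leg23_def)

lemma leg_add:
  assumes "x \<in> tensors2 s" "y \<in> tensors2 s"
  shows "leg12 s (x + y) = leg12 s x + leg12 s y"
    and "leg13 s (x + y) = leg13 s x + leg13 s y"
    and "leg23 s (x + y) = leg23 s x + leg23 s y"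
  using assms by (auto simp: tensors2_def cls2_add leg_cls2 cls3_add lin_ext_add)

lemma leg_pure2:
  "leg12 s (pure2 s a b) = pure3 s a b 1"
  "leg13 s (pure2 s a b) = pure3 s a 1 b"
  "leg23 s (pure2 s a b) = pure3 s 1 a b"
  by (simp_all add: pure2_def pure3_def leg_cls2)

lemma mult3_in_tensors3 [simp]: "x \<odot>\<^bsub>s\<^esub> y \<in> tensors3 s"
  by (simp add: mult3_def)

lemma act_in_tensors2 [simp]: "a \<rightharpoonup>\<^bsub>s\<^esub> x \<in> tensors2 s" "x \<leftharpoonup>\<^bsub>s\<^esub> a \<in> tensors2 s"
  by (simp_all add: left_act_def right_act_def)

lemma tensor_id_in_tensors3 [simp]: "tensor_id s f x \<in> tensors3 s" "id_tensor s f x \<in> tensors3 s"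
  by (simp_all add: tensor_id_def id_tensor_def)

lemma linear2D:
  assumes "linear2 s f"
  shows "f a \<in> tensors2 s" "f (a + b) = f a + f b" "f (s k a) = scale2 s k (f a)"
  using assms by (auto simp: linear2_def)

lemma linear2_zero:
  assumes "linear2 s f"
  shows "f 0 = cls2 s 0"
  using linear2D(2)[OF assms, of 0 0] tensors2_add_eq_left_iff[of "f 0" s "f 0"]
    linear2D(1)[OF assms] by simp

lemma linear2_add: "linear2 s f \<Longrightarrow> linear2 s g \<Longrightarrow> linear2 s (\<lambda>a. f a + g a)"
  by (simp add: linear2_def scale2_add add_ac)

section \<open>The bimodule of 2-tensors and the algebra of 3-tensors\<close>

context unital_algebra
begin

section \<open>The two commuting actions of \<open>A\<close> on \<open>A \<otimes> A\<close>\<close>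

lemma act_add:
  assumes "x \<in> tensors2 scale" "y \<in> tensors2 scale"
  shows "a \<rightharpoonup>\<^bsub>scale\<^esub> (x + y) = a \<rightharpoonup>\<^bsub>scale\<^esub> x + a \<rightharpoonup>\<^bsub>scale\<^esub> y"
    and "(x + y) \<leftharpoonup>\<^bsub>scale\<^esub> a = x \<leftharpoonup>\<^bsub>scale\<^esub> a + y \<leftharpoonup>\<^bsub>scale\<^esub> a"
  using assms by (auto simp: tensors2_def cls2_add act_cls2 lin_ext_add)

lemma act_zero: "a \<rightharpoonup>\<^bsub>scale\<^esub> cls2 scale 0 = cls2 scale 0" "cls2 scale 0 \<leftharpoonup>\<^bsub>scale\<^esub> a = cls2 scale 0"
  by (simp_all add: act_cls2 lin_ext_def)

lemma act_pure2:
  "a \<rightharpoonup>\<^bsub>scale\<^esub> pure2 scale b c = pure2 scale (a * b) c"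
  "pure2 scale b c \<leftharpoonup>\<^bsub>scale\<^esub> a = pure2 scale b (c * a)"
  by (simp_all add: pure2_def act_cls2)

lemma act_one:
  assumes "x \<in> tensors2 scale"
  shows "1 \<rightharpoonup>\<^bsub>scale\<^esub> x = x" "x \<leftharpoonup>\<^bsub>scale\<^esub> 1 = x"
  using assms by (induction rule: tensors2_induct) (simp_all add: act_pure2 act_add)

lemma act_mult:
  assumes "x \<in> tensors2 scale"
  shows "(a * b) \<rightharpoonup>\<^bsub>scale\<^esub> x = a \<rightharpoonup>\<^bsub>scale\<^esub> b \<rightharpoonup>\<^bsub>scale\<^esub> x"
    and "x \<leftharpoonup>\<^bsub>scale\<^esub> (a * b) = x \<leftharpoonup>\<^bsub>scale\<^esub> a \<leftharpoonup>\<^bsub>scale\<^esub> b"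
    and "(a \<rightharpoonup>\<^bsub>scale\<^esub> x) \<leftharpoonup>\<^bsub>scale\<^esub> b = a \<rightharpoonup>\<^bsub>scale\<^esub> (x \<leftharpoonup>\<^bsub>scale\<^esub> b)"
  using assms by (induction rule: tensors2_induct) (simp_all add: act_pure2 act_add mult.assoc)

text \<open>It makes \<open>a \<mapsto> u a\<close> an admissible argument of
  \<open>tensor_id\<close> and \<open>id_tensor\<close>, so that \<open>\<Delta>\<close> can be
  treated as this map plus a derivation.\<close>

lemma linear2_right_act:
  assumes "x \<in> tensors2 scale"
  shows "linear2 scale (\<lambda>a. x \<leftharpoonup>\<^bsub>scale\<^esub> a)"
proof -
  have "x \<leftharpoonup>\<^bsub>scale\<^esub> (a + b) = x \<leftharpoonup>\<^bsub>scale\<^esub> a + x \<leftharpoonup>\<^bsub>scale\<^esub> b" for a b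
    using assms
    by (induction rule: tensors2_induct)
       (simp_all add: act_pure2 act_add distrib_left pure2_add_right add_ac)
  moreover have "x \<leftharpoonup>\<^bsub>scale\<^esub> (scale k a) = scale2 scale k (x \<leftharpoonup>\<^bsub>scale\<^esub> a)" for k a
    using assms
    by (induction rule: tensors2_induct)
       (simp_all add: act_pure2 act_add scale2_add scale2_pure2 scale_mult_right)
  ultimately show ?thesis by (simp add: linear2_def)
qed

section \<open>The product on \<open>A \<otimes> A \<otimes> A\<close>\<close>

lemma mult3_add:
  assumes "x \<in> tensors3 scale" "y \<in> tensors3 scale" "z \<in> tensors3 scale"
  shows "(x + y) \<odot>\<^bsub>scale\<^esub> z = x \<odot>\<^bsub>scale\<^esub> z + y \<odot>\<^bsub>scale\<^esub> z"
    and "z \<odot>\<^bsub>scale\<^esub> (x + y) = z \<odot>\<^bsub>scale\<^esub> x + z \<odot>\<^bsub>scale\<^esub> y"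
  using assms
  \<comment> \<open>The right factor sits in the inner linear extension, so additivity in it also
    needs \<open>lin_ext_fun_add\<close> for the outer one.\<close>
  by (auto simp: tensors3_def cls3_add mult3_cls3 lin_ext_add case_prod_unfold lin_ext_fun_add)

lemma mult3_pure3:
  "pure3 scale a b c \<odot>\<^bsub>scale\<^esub> pure3 scale a' b' c' = pure3 scale (a * a') (b * b') (c * c')"
  by (simp add: pure3_def mult3_cls3)

text \<open>Additivity in each argument reduces the claim to three pure tensors, where it is
  associativity of \<open>A\<close> in every leg.\<close>

lemma mult3_assoc:
  assumes "x \<in> tensors3 scale" "y \<in> tensors3 scale" "z \<in> tensors3 scale"
  shows "(x \<odot>\<^bsub>scale\<^esub> y) \<odot>\<^bsub>scale\<^esub> z = x \<odot>\<^bsub>scale\<^esub> (y \<odot>\<^bsub>scale\<^esub> z)"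
  using assms
proof (induction arbitrary: y z rule: tensors3_induct)
  case (pure a b c)
  then show ?case
  proof (induction arbitrary: z rule: tensors3_induct)
    case (pure a' b' c')
    then show ?case
      by (induction rule: tensors3_induct) (simp_all add: mult3_pure3 mult3_add mult.assoc)
  qed (simp_all add: mult3_add)
qed (simp_all add: mult3_add)

section \<open>The maps \<open>f \<otimes> id\<close> and \<open>id \<otimes> f\<close> in terms of
  legs and products\<close>

lemma tensor_id_add:
  assumes "linear2 scale f" "x \<in> tensors2 scale" "y \<in> tensors2 scale"
  shows "tensor_id scale f (x + y) = tensor_id scale f x + tensor_id scale f y"
    and "id_tensor scale f (x + y) = id_tensor scale f x + id_tensor scale f y"
proof -
  \<comment> \<open>Each value of \<open>f\<close> is a coset; \<open>g\<close> chooses a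
    representative for every argument, as \<open>tensor_id_cls2\<close> requires.\<close>
  obtain g where g: "\<And>a. f a = cls2 scale (g a)"
    using assms(1) unfolding linear2_def tensors2_def image_def by (simp, metis)
  show "tensor_id scale f (x + y) = tensor_id scale f x + tensor_id scale f y"
    and "id_tensor scale f (x + y) = id_tensor scale f x + id_tensor scale f y"
    using assms(2,3)
    by (auto simp: tensors2_def cls2_add cls3_add tensor_id_cls2[OF assms(1) g] lin_ext_add)
qed

text \<open>The remaining factor is multiplied into the leg that \<open>f\<close> leaves empty. With
  this, later computations stay inside the algebra of 3-tensors and no longer touch formal
  combinations.\<close>

lemma tensor_id_pure2:
  assumes "linear2 scale f"
  shows "tensor_id scale f (pure2 scale a b) = leg12 scale (f a) \<odot>\<^bsub>scale\<^esub> pure3 scale 1 1 b"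
    and "id_tensor scale f (pure2 scale a b) = pure3 scale a 1 1 \<odot>\<^bsub>scale\<^esub> leg23 scale (f b)"
proof -
  obtain g where g: "\<And>a. f a = cls2 scale (g a)"
    using assms(1) unfolding linear2_def tensors2_def image_def by (simp, metis)
  \<comment> \<open>Both sides are additive in \<open>p\<close>, so scaled generators
    suffice.\<close>
  have L: "cls3 scale (lin_ext (\<lambda>(x, y). gen (x, y, b)) p) =
      leg12 scale (cls2 scale p) \<odot>\<^bsub>scale\<^esub> pure3 scale 1 1 b"
    and R: "cls3 scale (lin_ext (\<lambda>(x, y). gen (a, x, y)) p) =
      pure3 scale a 1 1 \<odot>\<^bsub>scale\<^esub> leg23 scale (cls2 scale p)" for p
    unfolding leg_cls2 pure3_def mult3_cls3
    by (induction p rule: free_induct)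
       (auto simp: lin_ext_add lin_ext_scale lin_ext_def[of _ 0] simp flip: cls3_add)
  show "tensor_id scale f (pure2 scale a b) = leg12 scale (f a) \<odot>\<^bsub>scale\<^esub> pure3 scale 1 1 b"
    and "id_tensor scale f (pure2 scale a b) = pure3 scale a 1 1 \<odot>\<^bsub>scale\<^esub> leg23 scale (f b)"
    unfolding pure2_def tensor_id_cls2[OF assms g] g L[symmetric] R[symmetric] by simp_all
qed

lemma tensor_id_fun_add:
  assumes "linear2 scale f" "linear2 scale g" "x \<in> tensors2 scale"
  shows "tensor_id scale (\<lambda>a. f a + g a) x = tensor_id scale f x + tensor_id scale g x"
    and "id_tensor scale (\<lambda>a. f a + g a) x = id_tensor scale f x + id_tensor scale g x"
  using assms(3)
  by (induction rule: tensors2_induct)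
     (simp_all add: assms linear2D linear2_add tensor_id_add tensor_id_pure2 leg_add mult3_add add_ac)

text \<open>On \<open>a \<otimes> b\<close> the first map gives \<open>u a \<otimes> b\<close>,
  which is \<open>u\<^sub>1\<^sub>2\<close> times \<open>1 \<otimes> a \<otimes> b\<close>. The
  second gives \<open>a \<otimes> u b\<close>, which is \<open>u\<^sub>2\<^sub>3\<close> times
  \<open>a \<otimes> 1 \<otimes> b\<close>. This is where the products of legs in the conditions on
  \<open>u\<close> come from.\<close>

lemma tensor_id_right_act_fun:
  assumes "u \<in> tensors2 scale" "x \<in> tensors2 scale"
  shows "tensor_id scale (\<lambda>a. u \<leftharpoonup>\<^bsub>scale\<^esub> a) x = leg12 scale u \<odot>\<^bsub>scale\<^esub> leg23 scale x"
    and "id_tensor scale (\<lambda>a. u \<leftharpoonup>\<^bsub>scale\<^esub> a) x = leg23 scale u \<odot>\<^bsub>scale\<^esub> leg13 scale x"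
proof -
  have L: "leg12 scale (u \<leftharpoonup>\<^bsub>scale\<^esub> a) \<odot>\<^bsub>scale\<^esub> pure3 scale 1 1 b = leg12 scale u \<odot>\<^bsub>scale\<^esub> pure3 scale 1 a b"
    and R: "pure3 scale a 1 1 \<odot>\<^bsub>scale\<^esub> leg23 scale (u \<leftharpoonup>\<^bsub>scale\<^esub> b) =
      leg23 scale u \<odot>\<^bsub>scale\<^esub> pure3 scale a 1 b" for a b
    using assms(1)
    by (induction rule: tensors2_induct)
       (simp_all add: act_pure2 act_add leg_add leg_pure2 mult3_pure3 mult3_add)
  show "tensor_id scale (\<lambda>a. u \<leftharpoonup>\<^bsub>scale\<^esub> a) x = leg12 scale u \<odot>\<^bsub>scale\<^esub> leg23 scale x"
    and "id_tensor scale (\<lambda>a. u \<leftharpoonup>\<^bsub>scale\<^esub> a) x = leg23 scale u \<odot>\<^bsub>scale\<^esub> leg13 scale x"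
    using assms(2)
    by (induction rule: tensors2_induct)
       (simp_all add: linear2_right_act[OF assms(1)] tensor_id_pure2 tensor_id_add leg_pure2 leg_add
          mult3_add L R)
qed

text \<open>The right action changes only the last factor of \<open>x\<close>, and both embeddings
  put that factor into leg 3.\<close>

lemma leg_right_act:
  assumes "x \<in> tensors2 scale"
  shows "leg13 scale (x \<leftharpoonup>\<^bsub>scale\<^esub> a) = leg13 scale x \<odot>\<^bsub>scale\<^esub> pure3 scale 1 1 a"
    and "leg23 scale (x \<leftharpoonup>\<^bsub>scale\<^esub> a) = leg23 scale x \<odot>\<^bsub>scale\<^esub> pure3 scale 1 1 a"
  using assms
  by (induction rule: tensors2_induct)
     (simp_all add: act_pure2 act_add leg_add leg_pure2 mult3_pure3 mult3_add)

text \<open>Here \<open>f\<close> acts on the first factor and \<open>a\<close> multiplies the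
  second, so the two operations commute.\<close>

lemma tensor_id_right_act:
  assumes "linear2 scale f" "x \<in> tensors2 scale"
  shows "tensor_id scale f (x \<leftharpoonup>\<^bsub>scale\<^esub> a) = tensor_id scale f x \<odot>\<^bsub>scale\<^esub> pure3 scale 1 1 a"
  using assms(2)
  by (induction rule: tensors2_induct)
     (simp_all add: act_pure2 act_add tensor_id_pure2 tensor_id_add mult3_add mult3_assoc
        mult3_pure3 assms(1))

section \<open>Derivations and the Leibniz rule on tensors\<close>

lemma derivationD:
  assumes "derivation scale \<delta>"
  shows "linear2 scale \<delta>" "\<delta> a \<in> tensors2 scale"
    and "\<delta> (a * b) = a \<rightharpoonup>\<^bsub>scale\<^esub> \<delta> b + \<delta> a \<leftharpoonup>\<^bsub>scale\<^esub> b"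
  using assms by (auto simp: derivation_def linear2_def)

text \<open>The Leibniz rule at \<open>1 * 1\<close> doubles the value, and cancellation makes it
  zero. This is why \<open>\<Delta> 1\<close> recovers \<open>u\<close>.\<close>

lemma derivation_one:
  assumes "derivation scale \<delta>"
  shows "\<delta> 1 = cls2 scale 0"
  using derivationD(3)[OF assms, of 1 1] tensors2_add_eq_left_iff[of "\<delta> 1" scale "\<delta> 1"]
  by (simp add: act_one derivationD(2)[OF assms])

text \<open>Now the derivation meets the product: for \<open>x = b \<otimes> c\<close> the second
  factor becomes \<open>\<delta> (c a) = c \<delta>(a) + \<delta>(c) a\<close>, and the summand
  \<open>b \<otimes> c \<delta>(a)\<close> is the correction term.\<close>

lemma id_tensor_derivation_right_act:
  assumes \<delta>: "derivation scale \<delta>" and "x \<in> tensors2 scale"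
  shows "id_tensor scale \<delta> (x \<leftharpoonup>\<^bsub>scale\<^esub> a) =
    id_tensor scale \<delta> x \<odot>\<^bsub>scale\<^esub> pure3 scale 1 1 a + leg12 scale x \<odot>\<^bsub>scale\<^esub> leg23 scale (\<delta> a)"
  using assms(2)
proof (induction rule: tensors2_induct)
  case (pure b c)
  \<comment> \<open>Left multiplication by \<open>c\<close> acts on leg 2, so \<open>c\<close> can
    move into the pure tensor on the left.\<close>
  have *: "pure3 scale b 1 1 \<odot>\<^bsub>scale\<^esub> leg23 scale (c \<rightharpoonup>\<^bsub>scale\<^esub> y) = pure3 scale b c 1 \<odot>\<^bsub>scale\<^esub> leg23 scale y"
    if "y \<in> tensors2 scale" for y
    using that
    by (induction rule: tensors2_induct)
       (simp_all add: act_pure2 act_add leg_add leg_pure2 mult3_pure3 mult3_add)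
  show ?case
    by (simp add: act_pure2 tensor_id_pure2 derivationD[OF \<delta>] leg_add leg_pure2 mult3_add
        leg_right_act mult3_assoc * add_ac)
qed (simp_all add: act_add tensor_id_add derivationD[OF \<delta>] mult3_add leg_add add_ac)

section \<open>Covariant derivations and the element \<open>\<Delta>(1)\<close>\<close>

text \<open>Without differences, the first condition on \<open>u\<close> says that the two formulas
  for \<open>\<Delta>\<close> agree, and the other two take the form in which coassociativity yields
  them.\<close>

lemma compatible_element_iff:
  assumes "derivation scale \<delta>1" "derivation scale \<delta>2"
  shows "compatible_element scale \<delta>1 \<delta>2 u \<longleftrightarrow> u \<in> tensors2 scale \<and>
     (\<forall>a. u \<leftharpoonup>\<^bsub>scale\<^esub> a + \<delta>1 a = a \<rightharpoonup>\<^bsub>scale\<^esub> u + \<delta>2 a) \<and>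
     (\<forall>a. tensor_id scale \<delta>1 (\<delta>1 a) =
        leg23 scale u \<odot>\<^bsub>scale\<^esub> leg13 scale (\<delta>1 a) + id_tensor scale \<delta>1 (\<delta>1 a)) \<and>
     leg12 scale u \<odot>\<^bsub>scale\<^esub> leg23 scale u + tensor_id scale \<delta>1 u =
        leg23 scale u \<odot>\<^bsub>scale\<^esub> leg13 scale u + id_tensor scale \<delta>1 u"
  by (simp add: compatible_element_def tensors2_minus_eq_minus_iff[where s = scale]
      tensors3_minus_eq_minus_iff[where s = scale] tensors3_minus_eq_iff[where s = scale]
      derivationD[OF assms(1)] derivationD[OF assms(2)] add.commute)

lemma coassociative_at_iff:
  assumes \<delta>: "derivation scale \<delta>" and u: "u \<in> tensors2 scale"
    and \<Delta>: "\<Delta> = (\<lambda>a. u \<leftharpoonup>\<^bsub>scale\<^esub> a + \<delta> a)"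
  shows "tensor_id scale \<Delta> (\<Delta> a) = id_tensor scale \<Delta> (\<Delta> a) \<longleftrightarrow>
    (leg12 scale u \<odot>\<^bsub>scale\<^esub> leg23 scale u + tensor_id scale \<delta> u) \<odot>\<^bsub>scale\<^esub> pure3 scale 1 1 a
        + tensor_id scale \<delta> (\<delta> a) =
    (leg23 scale u \<odot>\<^bsub>scale\<^esub> leg13 scale u + id_tensor scale \<delta> u) \<odot>\<^bsub>scale\<^esub> pure3 scale 1 1 a
        + (leg23 scale u \<odot>\<^bsub>scale\<^esub> leg13 scale (\<delta> a) + id_tensor scale \<delta> (\<delta> a))"
    (is "_ \<longleftrightarrow> ?l = ?r")
proof -
  \<comment> \<open>This term occurs on both sides: on the left as \<open>u\<close> applied to the
    first factor of \<open>\<delta> a\<close>, on the right as the Leibniz correction for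
    \<open>id \<otimes> \<delta>\<close> at \<open>u a\<close>.\<close>
  let ?m = "leg12 scale u \<odot>\<^bsub>scale\<^esub> leg23 scale (\<delta> a)"
  note simps = \<Delta> tensor_id_fun_add linear2_right_act tensor_id_right_act_fun tensor_id_add
    tensor_id_right_act id_tensor_derivation_right_act leg_add leg_right_act mult3_add mult3_assoc
    u \<delta> derivationD[OF \<delta>] add_ac
  have "tensor_id scale \<Delta> (\<Delta> a) = ?l + ?m" by (simp add: simps)
  moreover have "id_tensor scale \<Delta> (\<Delta> a) = ?r + ?m" by (simp add: simps)
  ultimately show ?thesis by (simp add: tensors3_cancel[where s = scale])
qed

lemma coassociative_iff:
  assumes \<delta>: "derivation scale \<delta>" and u: "u \<in> tensors2 scale"
    and \<Delta>: "\<Delta> = (\<lambda>a. u \<leftharpoonup>\<^bsub>scale\<^esub> a + \<delta> a)"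
  shows "coassociative scale \<Delta> \<longleftrightarrow>
     (\<forall>a. tensor_id scale \<delta> (\<delta> a) =
        leg23 scale u \<odot>\<^bsub>scale\<^esub> leg13 scale (\<delta> a) + id_tensor scale \<delta> (\<delta> a)) \<and>
     leg12 scale u \<odot>\<^bsub>scale\<^esub> leg23 scale u + tensor_id scale \<delta> u =
        leg23 scale u \<odot>\<^bsub>scale\<^esub> leg13 scale u + id_tensor scale \<delta> u"
    (is "_ \<longleftrightarrow> ?A \<and> ?B")
proof
  assume co: "coassociative scale \<Delta>"
  have at: "tensor_id scale \<Delta> (\<Delta> a) = id_tensor scale \<Delta> (\<Delta> a)" for a
    using co by (simp add: coassociative_def)
  have one: "\<Delta> 1 = u"
    by (simp add: \<Delta> derivation_one[OF \<delta>] act_one u)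
  \<comment> \<open>Since \<open>\<Delta> 1 = u\<close>, coassociativity at \<open>1\<close> is
    expanded directly on \<open>u\<close>; this avoids factors
    \<open>1 \<otimes> 1 \<otimes> 1\<close> and terms in \<open>\<delta> 1\<close>.\<close>
  have B: ?B
    using at[of 1] unfolding one
    by (simp add: \<Delta> tensor_id_fun_add linear2_right_act tensor_id_right_act_fun u derivationD[OF \<delta>])
  moreover have ?A
  proof
    fix a
    show "tensor_id scale \<delta> (\<delta> a) =
        leg23 scale u \<odot>\<^bsub>scale\<^esub> leg13 scale (\<delta> a) + id_tensor scale \<delta> (\<delta> a)"
      \<comment> \<open>Rewriting with \<open>B\<close> makes the multiples of
        \<open>1 \<otimes> 1 \<otimes> a\<close> on the two sides identical; commutativity then
        brings them into the position where they cancel.\<close>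
      using at[of a] unfolding coassociative_at_iff[OF \<delta> u \<Delta>] B
      by (subst (asm) (1 2) add.commute, subst (asm) tensors3_cancel[where s = scale]) simp_all
  qed
  ultimately show "?A \<and> ?B" by blast
next
  assume "?A \<and> ?B"
  then show "coassociative scale \<Delta>"
    unfolding coassociative_def coassociative_at_iff[OF \<delta> u \<Delta>] by simp
qed

text \<open>Setting the first factor to \<open>1\<close> in one covariance rule and the second in
  the other gives both formulas with \<open>u = \<Delta> 1\<close>. Conversely, each rule follows
  from one formula and the Leibniz rule of the derivation in it.\<close>

lemma covariant_derivation_iff:
  assumes \<delta>1: "derivation scale \<delta>1" and \<delta>2: "derivation scale \<delta>2"
  shows "covariant_derivation scale \<delta>1 \<delta>2 \<Delta> \<longleftrightarrow>
    (\<exists>u\<in>tensors2 scale. \<forall>a. \<Delta> a = u \<leftharpoonup>\<^bsub>scale\<^esub> a + \<delta>1 a \<and> \<Delta> a = a \<rightharpoonup>\<^bsub>scale\<^esub> u + \<delta>2 a)"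
proof
  assume cov: "covariant_derivation scale \<delta>1 \<delta>2 \<Delta>"
  then have t: "\<Delta> a \<in> tensors2 scale" for a
    by (simp add: covariant_derivation_def linear2_def)
  have "\<Delta> a = \<Delta> 1 \<leftharpoonup>\<^bsub>scale\<^esub> a + \<delta>1 a" for a
  proof -
    have "\<Delta> (1 * a) = \<Delta> 1 \<leftharpoonup>\<^bsub>scale\<^esub> a + 1 \<rightharpoonup>\<^bsub>scale\<^esub> \<delta>1 a"
      using cov unfolding covariant_derivation_def by blast
    then show ?thesis by (simp add: act_one derivationD[OF \<delta>1])
  qed
  moreover have "\<Delta> a = a \<rightharpoonup>\<^bsub>scale\<^esub> \<Delta> 1 + \<delta>2 a" for a
  proof -
    have "\<Delta> (a * 1) = a \<rightharpoonup>\<^bsub>scale\<^esub> \<Delta> 1 + \<delta>2 a \<leftharpoonup>\<^bsub>scale\<^esub> 1"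
      using cov unfolding covariant_derivation_def by blast
    then show ?thesis by (simp add: act_one derivationD[OF \<delta>2])
  qed
  ultimately show "\<exists>u\<in>tensors2 scale. \<forall>a. \<Delta> a = u \<leftharpoonup>\<^bsub>scale\<^esub> a + \<delta>1 a \<and> \<Delta> a = a \<rightharpoonup>\<^bsub>scale\<^esub> u + \<delta>2 a"
    using t by blast
next
  assume "\<exists>u\<in>tensors2 scale. \<forall>a. \<Delta> a = u \<leftharpoonup>\<^bsub>scale\<^esub> a + \<delta>1 a \<and> \<Delta> a = a \<rightharpoonup>\<^bsub>scale\<^esub> u + \<delta>2 a"
  then obtain u where u: "u \<in> tensors2 scale"
    and 1: "\<And>a. \<Delta> a = u \<leftharpoonup>\<^bsub>scale\<^esub> a + \<delta>1 a" and 2: "\<And>a. \<Delta> a = a \<rightharpoonup>\<^bsub>scale\<^esub> u + \<delta>2 a"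
    by blast
  have "linear2 scale \<Delta>"
    using linear2_add[OF linear2_right_act[OF u] derivationD(1)[OF \<delta>1]] by (simp add: 1[abs_def])
  moreover have "\<Delta> (a * b) = \<Delta> a \<leftharpoonup>\<^bsub>scale\<^esub> b + a \<rightharpoonup>\<^bsub>scale\<^esub> \<delta>1 b" for a b
    by (simp add: 1 act_mult act_add u derivationD[OF \<delta>1] add_ac)
  moreover have "\<Delta> (a * b) = a \<rightharpoonup>\<^bsub>scale\<^esub> \<Delta> b + \<delta>2 a \<leftharpoonup>\<^bsub>scale\<^esub> b" for a b
    by (simp add: 2 act_mult act_add u derivationD[OF \<delta>2] add_ac)
  ultimately show "covariant_derivation scale \<delta>1 \<delta>2 \<Delta>"
    unfolding covariant_derivation_def by blast
qed

text \<open>Folding both formulas back into \<open>\<Delta>\<close> makes the first condition on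
  \<open>u\<close> trivial; the other two are coassociativity.\<close>

lemma compatible_element_iff_coassociative:
  assumes \<delta>1: "derivation scale \<delta>1" and \<delta>2: "derivation scale \<delta>2" and u: "u \<in> tensors2 scale"
    and 1: "\<And>a. \<Delta> a = u \<leftharpoonup>\<^bsub>scale\<^esub> a + \<delta>1 a" and 2: "\<And>a. \<Delta> a = a \<rightharpoonup>\<^bsub>scale\<^esub> u + \<delta>2 a"
  shows "compatible_element scale \<delta>1 \<delta>2 u \<longleftrightarrow> coassociative scale \<Delta>"
  unfolding compatible_element_iff[OF \<delta>1 \<delta>2] coassociative_iff[OF \<delta>1 u ext[OF 1]]
  using u by (simp flip: 1 2)

section \<open>The constant subalgebra\<close>

text \<open>On a product of constants both Leibniz summands vanish, and the unit is constant by
  \<open>derivation_one\<close>.\<close>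

lemma subalgebra_constants:
  assumes \<delta>1: "derivation scale \<delta>1" and \<delta>2: "derivation scale \<delta>2"
  shows "subalgebra scale (constant_subalgebra scale \<delta>1 \<delta>2)"
proof -
  have "0 \<in> constant_subalgebra scale \<delta>1 \<delta>2"
    by (simp add: constant_subalgebra_def linear2_zero[OF derivationD(1)] assms)
  then show ?thesis
    unfolding subalgebra_def subspace_def
    by (auto simp: constant_subalgebra_def derivation_one assms linear2D[OF derivationD(1)]
      derivationD(3) act_zero scale2_zero)
qed

text \<open>The set \<open>B\<close> is arbitrary, so one equivalence serves twice: the constants
  themselves as \<open>B\<close> give bilinearity, and any other \<open>B\<close> gives
  maximality.\<close>

lemma bilinear_over_iff:
  assumes \<delta>1: "derivation scale \<delta>1" and \<delta>2: "derivation scale \<delta>2"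
    and cov: "covariant_derivation scale \<delta>1 \<delta>2 \<Delta>"
  shows "bilinear_over scale B \<Delta> \<longleftrightarrow> B \<subseteq> constant_subalgebra scale \<delta>1 \<delta>2"
proof -
  have 1: "\<Delta> (a * b) = \<Delta> a \<leftharpoonup>\<^bsub>scale\<^esub> b \<longleftrightarrow> a \<rightharpoonup>\<^bsub>scale\<^esub> \<delta>1 b = cls2 scale 0" for a b
  proof -
    have "\<Delta> (a * b) = \<Delta> a \<leftharpoonup>\<^bsub>scale\<^esub> b + a \<rightharpoonup>\<^bsub>scale\<^esub> \<delta>1 b"
      using cov unfolding covariant_derivation_def by blast
    then show ?thesis using tensors2_add_eq_left_iff act_in_tensors2 by metis
  qed
  have 2: "\<Delta> (b * a) = b \<rightharpoonup>\<^bsub>scale\<^esub> \<Delta> a \<longleftrightarrow> \<delta>2 b \<leftharpoonup>\<^bsub>scale\<^esub> a = cls2 scale 0" for a b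
  proof -
    have "\<Delta> (b * a) = b \<rightharpoonup>\<^bsub>scale\<^esub> \<Delta> a + \<delta>2 b \<leftharpoonup>\<^bsub>scale\<^esub> a"
      using cov unfolding covariant_derivation_def by blast
    then show ?thesis using tensors2_add_eq_left_iff act_in_tensors2 by metis
  qed
  have "(\<forall>a. a \<rightharpoonup>\<^bsub>scale\<^esub> \<delta>1 b = cls2 scale 0) \<longleftrightarrow> \<delta>1 b = cls2 scale 0"
    "(\<forall>a. \<delta>2 b \<leftharpoonup>\<^bsub>scale\<^esub> a = cls2 scale 0) \<longleftrightarrow> \<delta>2 b = cls2 scale 0" for b
    using act_one[of "\<delta>1 b"] act_one[of "\<delta>2 b"] act_zero
      derivationD(2)[OF \<delta>1] derivationD(2)[OF \<delta>2] by metis+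
  moreover have "bilinear_over scale B \<Delta> \<longleftrightarrow>
      (\<forall>b\<in>B. (\<forall>a. a \<rightharpoonup>\<^bsub>scale\<^esub> \<delta>1 b = cls2 scale 0) \<and> (\<forall>a. \<delta>2 b \<leftharpoonup>\<^bsub>scale\<^esub> a = cls2 scale 0))"
    unfolding bilinear_over_def 1 2 by metis
  ultimately show ?thesis
    by (simp add: constant_subalgebra_def subset_iff Ball_def)
qed

end

section \<open>Existence, the formulas for \<open>\<Delta>\<close>, and maximality of the
  constants\<close>

theorem proposition3p10:
  fixes scale :: "'k::field \<Rightarrow> 'a::{ring, monoid_mult} \<Rightarrow> 'a"
    and \<delta>1 \<delta>2 :: "'a \<Rightarrow> ('k, 'a) tensor2"
  assumes "unital_algebra scale"
    and "derivation scale \<delta>1"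
    and "derivation scale \<delta>2"
  shows
    "((\<exists>\<Delta>. covariant_derivation scale \<delta>1 \<delta>2 \<Delta> \<and> coassociative scale \<Delta>) \<longleftrightarrow>
      (\<exists>u. compatible_element scale \<delta>1 \<delta>2 u)) \<and>
     (\<forall>\<Delta>. covariant_derivation scale \<delta>1 \<delta>2 \<Delta> \<and> coassociative scale \<Delta> \<longrightarrow>
       (\<exists>u. compatible_element scale \<delta>1 \<delta>2 u \<and>
         (\<forall>a. \<Delta> a = u \<leftharpoonup>\<^bsub>scale\<^esub> a + \<delta>1 a \<and> \<Delta> a = a \<rightharpoonup>\<^bsub>scale\<^esub> u + \<delta>2 a))) \<and>
     (\<forall>u. compatible_element scale \<delta>1 \<delta>2 u \<longrightarrow>
       (\<exists>\<Delta>. covariant_derivation scale \<delta>1 \<delta>2 \<Delta> \<and> coassociative scale \<Delta> \<and>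
         (\<forall>a. \<Delta> a = u \<leftharpoonup>\<^bsub>scale\<^esub> a + \<delta>1 a \<and> \<Delta> a = a \<rightharpoonup>\<^bsub>scale\<^esub> u + \<delta>2 a))) \<and>
     (\<forall>\<Delta>. covariant_derivation scale \<delta>1 \<delta>2 \<Delta> \<and> coassociative scale \<Delta> \<longrightarrow>
       subalgebra scale (constant_subalgebra scale \<delta>1 \<delta>2) \<and>
       bilinear_over scale (constant_subalgebra scale \<delta>1 \<delta>2) \<Delta> \<and>
       (\<forall>B. subalgebra scale B \<and> bilinear_over scale B \<Delta> \<longrightarrow>
         B \<subseteq> constant_subalgebra scale \<delta>1 \<delta>2))"
proof -
  interpret unital_algebra scale by (rule assms(1))
  note \<delta> = assms(2,3)
  \<comment> \<open>The witness comes from \<open>covariant_derivation_iff\<close>, where it is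
    \<open>\<Delta> 1\<close>.\<close>
  have to_element: "\<exists>u. compatible_element scale \<delta>1 \<delta>2 u \<and>
      (\<forall>a. \<Delta> a = u \<leftharpoonup>\<^bsub>scale\<^esub> a + \<delta>1 a \<and> \<Delta> a = a \<rightharpoonup>\<^bsub>scale\<^esub> u + \<delta>2 a)"
    if "covariant_derivation scale \<delta>1 \<delta>2 \<Delta>" "coassociative scale \<Delta>" for \<Delta>
    using that covariant_derivation_iff[OF \<delta>] compatible_element_iff_coassociative[OF \<delta>] by metis
  have to_derivation: "\<exists>\<Delta>. covariant_derivation scale \<delta>1 \<delta>2 \<Delta> \<and> coassociative scale \<Delta> \<and>
      (\<forall>a. \<Delta> a = u \<leftharpoonup>\<^bsub>scale\<^esub> a + \<delta>1 a \<and> \<Delta> a = a \<rightharpoonup>\<^bsub>scale\<^esub> u + \<delta>2 a)"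
    if u: "compatible_element scale \<delta>1 \<delta>2 u" for u
  proof -
    \<comment> \<open>The first formula serves as definition; the first condition on
      \<open>u\<close> then supplies the second.\<close>
    define \<Delta> where "\<Delta> = (\<lambda>a. u \<leftharpoonup>\<^bsub>scale\<^esub> a + \<delta>1 a)"
    have *: "u \<in> tensors2 scale" "\<Delta> a = u \<leftharpoonup>\<^bsub>scale\<^esub> a + \<delta>1 a" "\<Delta> a = a \<rightharpoonup>\<^bsub>scale\<^esub> u + \<delta>2 a" for a
      using u by (simp_all add: compatible_element_iff[OF \<delta>] \<Delta>_def)
    then have "covariant_derivation scale \<delta>1 \<delta>2 \<Delta>"
      using covariant_derivation_iff[OF \<delta>] by blast
    moreover have "coassociative scale \<Delta>"
      using compatible_element_iff_coassociative[OF \<delta> *] u by simp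
    ultimately show ?thesis using *(2,3) by blast
  qed
  have constants: "subalgebra scale (constant_subalgebra scale \<delta>1 \<delta>2) \<and>
      bilinear_over scale (constant_subalgebra scale \<delta>1 \<delta>2) \<Delta> \<and>
      (\<forall>B. subalgebra scale B \<and> bilinear_over scale B \<Delta> \<longrightarrow> B \<subseteq> constant_subalgebra scale \<delta>1 \<delta>2)"
    if "covariant_derivation scale \<delta>1 \<delta>2 \<Delta>" for \<Delta>
    using subalgebra_constants[OF \<delta>] bilinear_over_iff[OF \<delta> that] by blast
  have "(\<exists>\<Delta>. covariant_derivation scale \<delta>1 \<delta>2 \<Delta> \<and> coassociative scale \<Delta>) \<longleftrightarrow>
      (\<exists>u. compatible_element scale \<delta>1 \<delta>2 u)"
    by (meson to_element to_derivation)
  then show ?thesis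
    by (intro conjI[OF _ conjI[OF _ conjI]] allI impI; (elim conjE)?)
       (assumption | rule to_element to_derivation constants)+
qed

end
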